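(* As formal power series in $y$, \[ \sum_{n\ge0} H_n(x) y^n = \frac{1 +xy(1+y) +2xy^3(1+y) -x^2y^3(1+y)^2}{1-xy^2(1+y)} = -2y+xy+xy^2+\frac{1+2y}{1-xy^2(1+y)}. \]
   Context: For $n\ge 0$, the $S$-fence $\phi_n$ is the poset on $\{x_1,\dots,x_n\}$ whose order is generated by the cover relations $x_2<x_1$, $x_3<x_2$, $x_2<x_4$, $x_5<x_4$, and, for every $i\ge 3$, $x_{2i-1}<x_{2i}$ and $x_{2i+1}<x_{2i}$, keeping only those relations whose elements both have index $\le n$ ($\phi_0$ is empty and $\Phi_0$ is a single vertex). A filter is an up-set. $\Phi_n$ is the underlying undirected graph of the Hasse diagram of the lattice of filters of $\phi_n$ ordered by reverse inclusion (two filters adjacent iff they differ in exactly one element). A maximal $k$-dimensional cube of $\Phi_n$ is an induced subgraph isomorphic to the hypercube $Q_k$ (with $Q_0$ a single vertex) not contained in any induced hypercube subgraph of larger dimension; $h_{n,k}$ is their number and $H_n(x)=\sum_{k\ge0}h_{n,k}x^k$. *)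

theory Defs
  imports
    "HOL-Computational_Algebra.Computational_Algebra"
    "Graph_Theory.Pair_Digraph"
    "Graph_Theory.Digraph_Isomorphism"
begin

(* A pair (a, b) stands for the cover relation x_a < x_b. *)
definition sfence_covers :: "(nat \<times> nat) set" where
  "sfence_covers =
     {(2, 1), (3, 2), (2, 4), (5, 4)} \<union>
     {(2 * i - 1, 2 * i) | i. 3 \<le> i} \<union> {(2 * i + 1, 2 * i) | i. 3 \<le> i}"

(* The reflexive pairs (a, a) with a outside {1..n} that the closure adds are harmless:
   the order is only ever used on subsets of {1..n}. *)
definition sfence_le :: "nat \<Rightarrow> (nat \<times> nat) set" where
  "sfence_le n = (Restr sfence_covers {1..n})\<^sup>*"

definition sfence_filters :: "nat \<Rightarrow> nat set set" where
  "sfence_filters n =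
     {F. F \<subseteq> {1..n} \<and> (\<forall>(a, b) \<in> sfence_le n. a \<in> F \<longrightarrow> b \<in> F)}"

(* The covering pairs of the filters under reverse inclusion:
   F precedes G iff G is a proper subset of F. *)
definition filter_hasse :: "nat \<Rightarrow> nat set pair_pre_digraph" where
  "filter_hasse n =
     \<lparr> pverts = sfence_filters n,
       parcs = {(F, G). F \<in> sfence_filters n \<and> G \<in> sfence_filters n \<and> G \<subset> F \<and>
                        \<not> (\<exists>K \<in> sfence_filters n. G \<subset> K \<and> K \<subset> F)} \<rparr>"

(* Undirected graphs are symmetric digraphs. *)
definition Phi :: "nat \<Rightarrow> nat set pair_pre_digraph" where
  "Phi n = mk_symmetric (filter_hasse n)"

definition hypercube :: "nat \<Rightarrow> nat set pair_pre_digraph" where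
  "hypercube k =
     \<lparr> pverts = Pow {..<k},
       parcs = {(A, B). A \<subseteq> {..<k} \<and> B \<subseteq> {..<k} \<and> card (sym_diff A B) = 1} \<rparr>"

definition induced_cube :: "'a pair_pre_digraph \<Rightarrow> nat \<Rightarrow> 'a pair_pre_digraph \<Rightarrow> bool" where
  "induced_cube G k Q \<longleftrightarrow> induced_subgraph Q G \<and> digraph_iso (hypercube k) Q"

definition maximal_cube :: "'a pair_pre_digraph \<Rightarrow> nat \<Rightarrow> 'a pair_pre_digraph \<Rightarrow> bool" where
  "maximal_cube G k Q \<longleftrightarrow>
     induced_cube G k Q \<and> \<not> (\<exists>l R. k < l \<and> induced_cube G l R \<and> subgraph Q R)"

definition max_cube_count :: "nat \<Rightarrow> nat \<Rightarrow> nat" where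
  "max_cube_count n k = card {Q. maximal_cube (Phi n) k Q}"

(* Only finitely many max_cube_count n k are nonzero, so this is the sum over all k; see coeff_max_cube_poly. *)
definition max_cube_poly :: "nat \<Rightarrow> int poly" where
  "max_cube_poly n = (\<Sum>k | max_cube_count n k \<noteq> 0. monom (int (max_cube_count n k)) k)"

lemma finite_sfence_filters: "finite (sfence_filters n)"
  by (rule finite_subset[of _ "Pow {1..n}"]) (auto simp: sfence_filters_def)

lemma sfence_le_rank:
  assumes "(a, b) \<in> sfence_le n" "a \<noteq> b"
  defines "r \<equiv> \<lambda>i::nat. if i = 2 then 1 else if odd i \<and> i \<noteq> 1 then 0 else (2::nat)"
  shows "r a < r b"
proof -
  have step: "r a < r b" if "(a, b) \<in> sfence_covers" for a b
    using that unfolding sfence_covers_def r_def by auto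
  from assms(1,2) have "(a, b) \<in> (Restr sfence_covers {1..n})\<^sup>+"
    unfolding sfence_le_def by (metis rtranclD)
  then show ?thesis
    by (induction rule: trancl_induct) (auto dest: step intro: less_trans)
qed

lemma arc_filter_hasse_iff:
  "(F, G) \<in> parcs (filter_hasse n) \<longleftrightarrow>
     F \<in> sfence_filters n \<and> G \<in> sfence_filters n \<and> G \<subseteq> F \<and> card (F - G) = 1"
proof (intro iffI conjI)
  assume "(F, G) \<in> parcs (filter_hasse n)"
  then have FG: "F \<in> sfence_filters n" "G \<in> sfence_filters n" "G \<subset> F"
    and no: "\<And>K. K \<in> sfence_filters n \<Longrightarrow> G \<subset> K \<Longrightarrow> \<not> K \<subset> F"
    by (auto simp: filter_hasse_def)
  show "F \<in> sfence_filters n" "G \<in> sfence_filters n" "G \<subseteq> F" using FG by auto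
  define r where "r = (\<lambda>i::nat. if i = 2 then 1 else if odd i \<and> i \<noteq> 1 then 0 else (2::nat))"
  have fin: "finite (F - G)"
    using FG(1) by (auto simp: sfence_filters_def intro: finite_subset)
  have "Max (r ` (F - G)) \<in> r ` (F - G)"
    using fin FG(3) by (intro Max_in) auto
  then obtain x where x: "x \<in> F - G" "r x = Max (r ` (F - G))" by auto
  have top: "r y \<le> r x" if "y \<in> F - G" for y
    using that fin x(2) by simp
  have "insert x G \<in> sfence_filters n"
  proof -
    have "b \<in> insert x G" if ab: "(a, b) \<in> sfence_le n" and "a \<in> insert x G" for a b
    proof (cases "a = x")
      case True
      have "b \<in> F" using ab True x(1) FG(1) by (auto simp: sfence_filters_def)
      then show ?thesis
        using sfence_le_rank[OF ab] top[of b] True unfolding r_def by fastforce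
    next
      case False
      then show ?thesis using that FG(2) by (auto simp: sfence_filters_def)
    qed
    then show ?thesis using x(1) FG(1,2) by (auto simp: sfence_filters_def)
  qed
  with no x(1) FG(3) have "F = insert x G" by blast
  then have "F - G = {x}" using x(1) by auto
  then show "card (F - G) = 1" by simp
next
  assume *: "F \<in> sfence_filters n \<and> G \<in> sfence_filters n \<and> G \<subseteq> F \<and> card (F - G) = 1"
  then obtain x where x: "F - G = {x}" by (auto simp: card_1_singleton_iff)
  have "\<not> (G \<subset> K \<and> K \<subset> F)" for K
  proof
    assume K: "G \<subset> K \<and> K \<subset> F"
    then obtain u v where "u \<in> K" "u \<notin> G" "v \<in> F" "v \<notin> K" by blast
    moreover from this K have "u \<in> {x}" "v \<in> {x}" unfolding x[symmetric] by blast+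
    ultimately show False by simp
  qed
  moreover have "G \<subset> F" using * x by blast
  ultimately show "(F, G) \<in> parcs (filter_hasse n)" using * by (simp add: filter_hasse_def)
qed

(* Two filters are adjacent iff they differ in exactly one element. *)
lemma arc_Phi_iff:
  "(F, G) \<in> parcs (Phi n) \<longleftrightarrow>
     F \<in> sfence_filters n \<and> G \<in> sfence_filters n \<and> card (sym_diff F G) = 1"
proof -
  have "(F, G) \<in> parcs (Phi n) \<longleftrightarrow>
      (F, G) \<in> parcs (filter_hasse n) \<or> (G, F) \<in> parcs (filter_hasse n)"
  proof -
    have "(F, G) \<in> (\<Union>e\<in>A. {(fst e, snd e), (snd e, fst e)}) \<longleftrightarrow> (F, G) \<in> A \<or> (G, F) \<in> A"
      for A :: "(nat set \<times> nat set) set"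
      by (auto intro: bexI[of _ "(F, G)"] bexI[of _ "(G, F)"])
    then show ?thesis by (simp add: Phi_def mk_symmetric_def)
  qed
  also have "\<dots> \<longleftrightarrow>
     F \<in> sfence_filters n \<and> G \<in> sfence_filters n \<and> card (sym_diff F G) = 1"
  proof -
    have "card (sym_diff F G) = 1 \<longleftrightarrow>
        (G \<subseteq> F \<and> card (F - G) = 1) \<or> (F \<subseteq> G \<and> card (G - F) = 1)"
    proof -
      have "G \<subseteq> F \<or> F \<subseteq> G" if "card (sym_diff F G) = 1"
      proof -
        from that obtain x where x: "sym_diff F G = {x}" by (auto simp: card_1_singleton_iff)
        show ?thesis
        proof (rule ccontr)
          assume "\<not> (G \<subseteq> F \<or> F \<subseteq> G)"
          then obtain u v where "u \<in> G" "u \<notin> F" "v \<in> F" "v \<notin> G" by blast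
          moreover from this have "u \<in> {x}" "v \<in> {x}" unfolding x[symmetric] by simp_all
          ultimately show False by simp
        qed
      qed
      moreover have "sym_diff F G = F - G" if "G \<subseteq> F" using that by blast
      moreover have "sym_diff F G = G - F" if "F \<subseteq> G" using that by blast
      ultimately show ?thesis by metis
    qed
    then show ?thesis unfolding arc_filter_hasse_iff by blast
  qed
  finally show ?thesis .
qed

lemma pverts_Phi: "pverts (Phi n) = sfence_filters n"
  by (simp add: Phi_def mk_symmetric_def filter_hasse_def)

lemma pair_graph_Phi: "pair_graph (Phi n)"
proof
  fix e assume "e \<in> parcs (Phi n)"
  then show "fst e \<in> pverts (Phi n)" "snd e \<in> pverts (Phi n)" "fst e \<noteq> snd e"
    by (cases e; auto simp: arc_Phi_iff pverts_Phi)+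
next
  show fv: "finite (pverts (Phi n))" by (simp add: pverts_Phi finite_sfence_filters)
  show "finite (parcs (Phi n))"
    by (rule finite_subset[of _ "pverts (Phi n) \<times> pverts (Phi n)"])
       (use fv in \<open>auto simp: arc_Phi_iff pverts_Phi\<close>)
next
  show "symmetric (with_proj (Phi n))"
    unfolding symmetric_def sym_def
    by (auto simp: arcs_ends_def arc_to_ends_def arc_Phi_iff Un_commute)
qed

lemma finite_maximal_cubes: "finite {Q. maximal_cube (Phi n) k Q}"
proof -
  interpret pair_graph "Phi n" by (rule pair_graph_Phi)
  have "{Q. maximal_cube (Phi n) k Q} \<subseteq>
      (\<lambda>(V, E). \<lparr> pverts = V, parcs = E \<rparr>) ` (Pow (pverts (Phi n)) \<times> Pow (parcs (Phi n)))"
  proof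
    fix Q assume "Q \<in> {Q. maximal_cube (Phi n) k Q}"
    then have "pverts Q \<subseteq> pverts (Phi n)" "parcs Q \<subseteq> parcs (Phi n)"
      by (auto simp: maximal_cube_def induced_cube_def induced_subgraph_def subgraph_def)
    then show "Q \<in> (\<lambda>(V, E). \<lparr> pverts = V, parcs = E \<rparr>) `
        (Pow (pverts (Phi n)) \<times> Pow (parcs (Phi n)))"
      by (intro image_eqI[of _ _ "(pverts Q, parcs Q)"]) auto
  qed
  then show ?thesis
    by (rule finite_subset) (simp add: pair_finite_verts pair_finite_arcs)
qed

lemma finite_max_cube_count_support: "finite {k. max_cube_count n k \<noteq> 0}"
proof (rule finite_subset)
  show "{k. max_cube_count n k \<noteq> 0} \<subseteq> {..n}"
  proof
    fix k assume "k \<in> {k. max_cube_count n k \<noteq> 0}"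
    then have "\<exists>Q. maximal_cube (Phi n) k Q" by (auto simp: max_cube_count_def card_gt_0_iff)
    then obtain Q :: "nat set pair_pre_digraph"
      where Q: "induced_subgraph Q (Phi n)" "digraph_iso (hypercube k) Q"
      by (auto simp: maximal_cube_def induced_cube_def)
    from Q(2) obtain g where
      g: "pre_digraph.digraph_isomorphism (hypercube k) g" "with_proj Q = app_iso g (hypercube k)"
      unfolding digraph_iso_def by blast
    then have f: "inj_on (iso_verts g) (pverts (hypercube k))"
      by (simp add: pre_digraph.digraph_isomorphism_def)
    have "verts (with_proj Q) = iso_verts g ` pverts (hypercube k)"
      unfolding g(2) by simp
    then have f': "pverts Q = iso_verts g ` pverts (hypercube k)" by simp
    have "2 ^ k = card (pverts Q)"
      using f unfolding f' by (simp add: card_image hypercube_def card_Pow)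
    also have "\<dots> \<le> card (Pow {1..n})"
      using Q(1) by (intro card_mono)
        (auto simp: induced_subgraph_def subgraph_def pverts_Phi sfence_filters_def)
    also have "\<dots> = 2 ^ n" by (simp add: card_Pow)
    finally show "k \<in> {..n}" by simp
  qed
qed simp

lemma coeff_max_cube_poly: "coeff (max_cube_poly n) k = int (max_cube_count n k)"
proof -
  have "coeff (max_cube_poly n) k = (\<Sum>j | max_cube_count n j \<noteq> 0. if j = k then int (max_cube_count n j) else 0)"
    by (simp add: max_cube_poly_def coeff_sum)
  also have "\<dots> = int (max_cube_count n k)"
    by (subst sum.delta[OF finite_max_cube_count_support]) auto
  finally show ?thesis .
qed

end

theory Submission
  imports Defs
begin

text \<open>
  The graph of filters is an induced subgraph of a hypercube of subsets, and opposite edges of a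
  square there change the same element. So an induced cube is a family \<open>{B \<union> S | S. S \<subseteq> A}\<close>
  of filters, that is, a labeling of the fence by \<open>Out\<close>, \<open>Free\<close> (the set \<open>A\<close>) and
  \<open>In\<close> (the set \<open>B\<close>), where a cover of an element not labeled \<open>Out\<close> is labeled
  \<open>In\<close>. A cube that is not maximal can be enlarged by relabeling a single element as
  \<open>Free\<close>, so maximality is a local condition on the labeling. On the regular part of the fence
  it says that the \<open>Free\<close> elements form a maximal independent set of a path; deleting the last
  such element together with its neighbours gives \<open>H\<^sub>n = x (H\<^sub>n\<^sub>-\<^sub>2 + H\<^sub>n\<^sub>-\<^sub>3)\<close> for
  \<open>n \<ge> 6\<close>, and the smaller cases are enumerated.
\<close>

section \<open>Cubes in graphs of sets\<close>

text \<open>Both \<open>hypercube k\<close> and \<open>Phi n\<close> have this form, so cubes in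
  \<open>Phi n\<close> can be studied as maps between families of sets.\<close>

definition set_graph :: "'a set set \<Rightarrow> 'a set pair_pre_digraph" where
  "set_graph V = \<lparr> pverts = V, parcs = {(F, G). F \<in> V \<and> G \<in> V \<and> card (sym_diff F G) = 1} \<rparr>"

text \<open>For disjoint \<open>A\<close> and \<open>B\<close> this is the interval from
  \<open>B\<close> to \<open>B \<union> A\<close> in the Boolean lattice.\<close>

definition subcube :: "'a set \<Rightarrow> 'a set \<Rightarrow> 'a set set" where
  "subcube B A = (\<lambda>S. B \<union> S) ` Pow A"

lemma pverts_set_graph [simp]: "pverts (set_graph V) = V"
  and parcs_set_graph:
    "parcs (set_graph V) = {(F, G). F \<in> V \<and> G \<in> V \<and> card (sym_diff F G) = 1}"
  by (simp_all add: set_graph_def)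

lemma wf_set_graph: "wf_digraph (with_proj (set_graph V))"
  by unfold_locales (auto simp: parcs_set_graph)

lemma hypercube_eq_set_graph: "hypercube k = set_graph (Pow {..<k})"
  by (auto simp: hypercube_def set_graph_def)

lemma Phi_eq_set_graph: "Phi n = set_graph (sfence_filters n)"
proof -
  have "parcs (Phi n) = parcs (set_graph (sfence_filters n))"
    by (auto simp: arc_Phi_iff parcs_set_graph)
  then show ?thesis
    using pverts_Phi[of n] by (simp add: pair_pre_digraph.equality)
qed

lemma subgraph_set_graph_iff:
  "subgraph (with_proj (set_graph W)) (with_proj (set_graph V)) \<longleftrightarrow> W \<subseteq> V"
  by (auto simp: subgraph_def wf_set_graph compatible_def parcs_set_graph)

text \<open>The vertices determine an induced subgraph, so subgraphs can be replaced by subfamilies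
  of \<open>V\<close>.\<close>

lemma induced_subgraph_set_graph_iff:
  "induced_subgraph (with_proj Q) (with_proj (set_graph V)) \<longleftrightarrow> (\<exists>W \<subseteq> V. Q = set_graph W)"
proof
  assume Q: "induced_subgraph (with_proj Q) (with_proj (set_graph V))"
  then have sub: "pverts Q \<subseteq> V"
    by (auto simp: induced_subgraph_def subgraph_def)
  have "parcs Q = parcs (set_graph (pverts Q))"
    using Q sub by (auto simp: induced_subgraph_def parcs_set_graph)
  then have "Q = set_graph (pverts Q)"
    by (simp add: pair_pre_digraph.equality)
  with sub show "\<exists>W \<subseteq> V. Q = set_graph W" by blast
next
  assume "\<exists>W \<subseteq> V. Q = set_graph W"
  then obtain W where W: "W \<subseteq> V" "Q = set_graph W" by blast
  then show "induced_subgraph (with_proj Q) (with_proj (set_graph V))"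
    by (auto simp: induced_subgraph_def subgraph_set_graph_iff parcs_set_graph)
qed

text \<open>Arcs are pairs of their ends, so the arc map of an isomorphism is forced by its vertex
  map and only adjacency remains to be compared.\<close>

lemma digraph_iso_set_graph_iff:
  "digraph_iso (with_proj (set_graph V)) (with_proj (set_graph W)) \<longleftrightarrow>
     (\<exists>h. bij_betw h V W \<and>
        (\<forall>F \<in> V. \<forall>G \<in> V. card (sym_diff (h F) (h G)) = 1 \<longleftrightarrow> card (sym_diff F G) = 1))"
proof
  assume "digraph_iso (with_proj (set_graph V)) (with_proj (set_graph W))"
  then obtain g where g: "pre_digraph.digraph_isomorphism (with_proj (set_graph V)) g"
    and W: "with_proj (set_graph W) = app_iso g (with_proj (set_graph V))"
    by (auto simp: digraph_iso_def)
  let ?h = "iso_verts g"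
  have inj: "inj_on ?h V" using g by (simp add: pre_digraph.digraph_isomorphism_def)
  have "verts (with_proj (set_graph W)) = ?h ` V" by (simp add: W)
  then have img: "W = ?h ` V" by simp
  have "tail (with_proj (set_graph W)) = iso_tail g" "head (with_proj (set_graph W)) = iso_head g"
    by (simp_all add: W app_iso_def)
  then have th: "iso_tail g = fst" "iso_head g = snd" by simp_all
  have ends: "iso_arcs g e = (?h (fst e), ?h (snd e))" if "e \<in> parcs (set_graph V)" for e
  proof -
    have "?h (fst e) = fst (iso_arcs g e)" "?h (snd e) = snd (iso_arcs g e)"
      using g that th by (auto simp: pre_digraph.digraph_isomorphism_def)
    then show ?thesis by (simp add: prod_eq_iff)
  qed
  have "arcs (with_proj (set_graph W)) = iso_arcs g ` parcs (set_graph V)" by (simp add: W)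
  then have parcs: "parcs (set_graph W) = (\<lambda>e. (?h (fst e), ?h (snd e))) ` parcs (set_graph V)"
    by (simp only: with_proj_simps image_cong[OF refl ends])
  \<comment> \<open>Injectivity of \<open>?h\<close> makes adjacency reflect: an arc between images
    comes only from an arc between the originals.\<close>
  have mem: "(?h F, ?h G) \<in> (\<lambda>e. (?h (fst e), ?h (snd e))) ` parcs (set_graph V) \<longleftrightarrow>
      (F, G) \<in> parcs (set_graph V)" if FG: "F \<in> V" "G \<in> V" for F G
  proof
    assume "(?h F, ?h G) \<in> (\<lambda>e. (?h (fst e), ?h (snd e))) ` parcs (set_graph V)"
    then obtain F' G' where FG': "(F', G') \<in> parcs (set_graph V)" "?h F = ?h F'" "?h G = ?h G'"
      by auto
    then have "F = F'" "G = G'"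
      using inj FG by (auto simp: parcs_set_graph dest: inj_onD)
    with FG' show "(F, G) \<in> parcs (set_graph V)" by simp
  qed (rule image_eqI[of _ _ "(F, G)"], auto)
  have "card (sym_diff (?h F) (?h G)) = 1 \<longleftrightarrow> card (sym_diff F G) = 1"
    if FG: "F \<in> V" "G \<in> V" for F G
    using mem[OF FG] FG img unfolding parcs[symmetric] by (simp add: parcs_set_graph)
  then show "\<exists>h. bij_betw h V W \<and>
        (\<forall>F \<in> V. \<forall>G \<in> V. card (sym_diff (h F) (h G)) = 1 \<longleftrightarrow> card (sym_diff F G) = 1)"
    using inj img by (intro exI[of _ ?h]) (simp add: bij_betw_def)
next
  assume "\<exists>h. bij_betw h V W \<and>
        (\<forall>F \<in> V. \<forall>G \<in> V. card (sym_diff (h F) (h G)) = 1 \<longleftrightarrow> card (sym_diff F G) = 1)"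
  then obtain h where bij: "bij_betw h V W"
    and adj: "\<And>F G. F \<in> V \<Longrightarrow> G \<in> V \<Longrightarrow>
      card (sym_diff (h F) (h G)) = 1 \<longleftrightarrow> card (sym_diff F G) = 1"
    by blast
  then have inj: "inj_on h V" and img: "W = h ` V" by (simp_all add: bij_betw_def)
  \<comment> \<open>Arcs are moved through their two ends, so head and tail remain the
    projections.\<close>
  let ?g = "\<lparr> iso_verts = h, iso_arcs = map_prod h h, iso_head = snd, iso_tail = fst \<rparr>"
  have "inj_on (map_prod h h) (parcs (set_graph V))"
    by (rule inj_on_subset[OF map_prod_inj_on[OF inj inj]]) (auto simp: parcs_set_graph)
  then have "pre_digraph.digraph_isomorphism (with_proj (set_graph V)) ?g"
    using inj wf_set_graph by (auto simp: pre_digraph.digraph_isomorphism_def)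
  moreover have "parcs (set_graph W) = map_prod h h ` parcs (set_graph V)"
  proof (intro equalityI subrelI)
    fix F' G' assume "(F', G') \<in> parcs (set_graph W)"
    then obtain F G where "F \<in> V" "G \<in> V" "F' = h F" "G' = h G" "card (sym_diff (h F) (h G)) = 1"
      by (auto simp: parcs_set_graph img)
    then show "(F', G') \<in> map_prod h h ` parcs (set_graph V)"
      using adj by (intro image_eqI[of _ _ "(F, G)"]) (simp_all add: parcs_set_graph)
  next
    fix F' G' assume "(F', G') \<in> map_prod h h ` parcs (set_graph V)"
    then show "(F', G') \<in> parcs (set_graph W)"
      using adj by (auto simp: parcs_set_graph img)
  qed
  then have "with_proj (set_graph W) = app_iso ?g (with_proj (set_graph V))"
    by (simp add: app_iso_def with_proj_def img)
  ultimately show "digraph_iso (with_proj (set_graph V)) (with_proj (set_graph W))"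
    unfolding digraph_iso_def by blast
qed

section \<open>Embedded cubes are intervals of sets\<close>

lemma sym_diff_eq_singleton_iff: "sym_diff X Y = {p} \<longleftrightarrow> Y = sym_diff X {p}"
  by blast

lemma sym_diff_insert:
  "p \<notin> U \<Longrightarrow> sym_diff X (insert p U) = sym_diff (sym_diff X U) {p}"
  by blast

text \<open>Rigidity of squares: toggling \<open>r\<close> in \<open>sym_diff X {p}\<close> reaches
  a neighbour of \<open>sym_diff X {q}\<close> only for \<open>r = p\<close>, which returns to
  \<open>X\<close>, or for \<open>r = q\<close>.\<close>

lemma square_opposite_corner:
  assumes "card (sym_diff (sym_diff X {p}) Z) = 1" "card (sym_diff (sym_diff X {q}) Z) = 1"
    and "p \<noteq> q" "Z \<noteq> X"
  shows "Z = sym_diff X {p, q}"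
proof -
  obtain r where r: "Z = sym_diff (sym_diff X {p}) {r}"
    using assms(1) by (auto simp: card_1_singleton_iff sym_diff_eq_singleton_iff)
  obtain s where s: "Z = sym_diff (sym_diff X {q}) {s}"
    using assms(2) by (auto simp: card_1_singleton_iff sym_diff_eq_singleton_iff)
  have eq: "t \<in> sym_diff (sym_diff X {p}) {r} \<longleftrightarrow> t \<in> sym_diff (sym_diff X {q}) {s}" for t
    using r s by simp
  \<comment> \<open>If \<open>p\<close>, \<open>q\<close>, \<open>r\<close> were distinct, the two
    sides without \<open>s\<close> would differ at all three, and toggling \<open>s\<close> corrects
    only one point.\<close>
  have "r = p \<or> r = q" using eq[of p] eq[of q] eq[of r] \<open>p \<noteq> q\<close> by auto
  moreover have "r \<noteq> p" using r \<open>Z \<noteq> X\<close> by blast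
  ultimately show ?thesis using r \<open>p \<noteq> q\<close> by auto
qed

text \<open>By rigidity of squares, all edges in direction \<open>i\<close> toggle the same element
  \<open>c i\<close>. Hence \<open>h\<close> is the image map of \<open>c\<close> followed by the
  symmetric difference with \<open>h {}\<close>.\<close>

lemma cube_embedding_image:
  fixes h :: "nat set \<Rightarrow> 'a set"
  assumes inj: "inj_on h (Pow {..<k})"
    and adj: "\<And>S i. S \<subseteq> {..<k} \<Longrightarrow> i < k \<Longrightarrow> i \<notin> S \<Longrightarrow>
      card (sym_diff (h S) (h (insert i S))) = 1"
  obtains B A where "A \<inter> B = {}" "finite A" "card A = k" "h ` Pow {..<k} = subcube B A"
proof -
  have "\<exists>c. \<forall>i<k. h {i} = sym_diff (h {}) {c i}"
  proof -
    have "\<exists>p. h {i} = sym_diff (h {}) {p}" if "i < k" for i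
      using adj[of "{}" i] that by (auto simp: card_1_singleton_iff sym_diff_eq_singleton_iff)
    then show ?thesis by metis
  qed
  then obtain c where c: "\<And>i. i < k \<Longrightarrow> h {i} = sym_diff (h {}) {c i}" by blast
  have c_inj: "inj_on c {..<k}"
  proof (rule inj_onI)
    fix i j assume ij: "i \<in> {..<k}" "j \<in> {..<k}" "c i = c j"
    then have "h {i} = h {j}" using c by simp
    then have "{i} = {j}" using inj ij by (auto dest: inj_onD)
    then show "i = j" by simp
  qed
  \<comment> \<open>Sets with at most one element are covered by the choice of \<open>c\<close>. A
    larger \<open>S\<close> is the corner opposite \<open>T\<close> in a square whose other three
    corners are smaller sets.\<close>
  have h_eq: "h S = sym_diff (h {}) (c ` S)" if "S \<subseteq> {..<k}" for S
    using that
  proof (induction "card S" arbitrary: S rule: less_induct)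
    case less
    have finS: "finite S" using less.prems finite_subset by blast
    consider "S = {}" | i where "S = {i}" | i j where "i \<in> S" "j \<in> S" "i \<noteq> j"
      by blast
    then show ?case
    proof cases
      case 1 then show ?thesis by simp
    next
      case 2 then show ?thesis using c less.prems by simp
    next
      case (3 i j)
      define T where "T = S - {i, j}"
      have 3: "S = insert i (insert j T)" "i \<noteq> j" "i \<notin> T" "j \<notin> T"
        using 3 by (auto simp: T_def)
      then have T: "i < k" "j < k" "T \<subseteq> {..<k}" "finite T" using less.prems finS by auto
      have hT: "h T = sym_diff (h {}) (c ` T)"
        and hi: "h (insert i T) = sym_diff (h {}) (c ` insert i T)"
        and hj: "h (insert j T) = sym_diff (h {}) (c ` insert j T)"
        using 3 T by (intro less.hyps; simp)+
      have new: "c i \<notin> c ` T" "c j \<notin> c ` T" "c i \<noteq> c j"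
        using c_inj 3 T by (auto simp: inj_on_def)
      have i: "h (insert i T) = sym_diff (h T) {c i}"
        unfolding hT hi image_insert by (rule sym_diff_insert[OF new(1)])
      have j: "h (insert j T) = sym_diff (h T) {c j}"
        unfolding hT hj image_insert by (rule sym_diff_insert[OF new(2)])
      have ij: "sym_diff (h T) {c i, c j} = sym_diff (sym_diff (h T) {c j}) {c i}"
        using new(3) by auto
      have "h S = sym_diff (h T) {c i, c j}"
      proof (rule square_opposite_corner)
        show "card (sym_diff (sym_diff (h T) {c i}) (h S)) = 1"
          unfolding i[symmetric] using adj[of "insert i T" j] 3 T by (simp add: insert_commute)
        show "card (sym_diff (sym_diff (h T) {c j}) (h S)) = 1"
          unfolding j[symmetric] using adj[of "insert j T" i] 3 T by simp
        \<comment> \<open>Injectivity excludes the other common neighbour, \<open>h T\<close>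
          itself.\<close>
        have "T \<in> Pow {..<k}" "S \<in> Pow {..<k}" "T \<noteq> S" using T less.prems 3 by auto
        then show "h S \<noteq> h T" using inj by (auto dest: inj_onD)
      qed (fact new)
      also have "\<dots> = sym_diff (sym_diff (h {}) (c ` insert j T)) {c i}"
        unfolding ij j[symmetric] hj ..
      also have "\<dots> = sym_diff (h {}) (c ` S)"
        unfolding 3(1) image_insert[of c i] using new by (subst sym_diff_insert) auto
      finally show ?thesis .
    qed
  qed
  \<comment> \<open>\<open>h {}\<close> need not be the least member of the image, so its part
    inside \<open>?A\<close> is dropped from the base; toggling that part permutes the subsets of
    \<open>?A\<close>.\<close>
  let ?A = "c ` {..<k}" and ?B = "h {} - c ` {..<k}"
  have Pow_A: "image c ` Pow {..<k} = Pow ?A" by (rule image_Pow_surj) simp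
  have "h ` Pow {..<k} = (\<lambda>S. sym_diff (h {}) S) ` image c ` Pow {..<k}"
    unfolding image_image by (intro image_cong refl h_eq) simp
  also have "\<dots> = subcube ?B ?A"
    unfolding Pow_A subcube_def
  proof (intro equalityI image_subsetI)
    fix S assume "S \<in> Pow ?A"
    then have "sym_diff (h {}) S = ?B \<union> sym_diff (h {} \<inter> ?A) S" by blast
    moreover have "sym_diff (h {} \<inter> ?A) S \<in> Pow ?A" using \<open>S \<in> Pow ?A\<close> by blast
    ultimately show "sym_diff (h {}) S \<in> (\<lambda>S. ?B \<union> S) ` Pow ?A" by (rule image_eqI)
  next
    fix S assume "S \<in> Pow ?A"
    then have "?B \<union> S = sym_diff (h {}) (sym_diff (h {} \<inter> ?A) S)" by blast
    moreover have "sym_diff (h {} \<inter> ?A) S \<in> Pow ?A" using \<open>S \<in> Pow ?A\<close> by blast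
    ultimately show "?B \<union> S \<in> (\<lambda>S. sym_diff (h {}) S) ` Pow ?A" by (rule image_eqI)
  qed
  finally have img: "h ` Pow {..<k} = subcube ?B ?A" .
  show thesis
  proof
    show "?A \<inter> ?B = {}" by blast
    show "finite ?A" by simp
    show "card ?A = k" using c_inj by (simp add: card_image)
  qed (fact img)
qed

text \<open>The embedding lemma gives one direction; for the other, any numbering \<open>e\<close>
  of \<open>A\<close> by \<open>{..<k}\<close> induces the isomorphism.\<close>

lemma induced_cube_set_graph_iff:
  "induced_cube (set_graph V) k Q \<longleftrightarrow>
     (\<exists>B A. A \<inter> B = {} \<and> finite A \<and> card A = k \<and> subcube B A \<subseteq> V \<and> Q = set_graph (subcube B A))"
proof
  assume "induced_cube (set_graph V) k Q"
  then obtain W where W: "W \<subseteq> V" "Q = set_graph W"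
    and iso: "digraph_iso (with_proj (set_graph (Pow {..<k}))) (with_proj (set_graph W))"
    unfolding induced_cube_def induced_subgraph_set_graph_iff hypercube_eq_set_graph by blast
  obtain h where h: "bij_betw h (Pow {..<k}) W"
    and adj: "\<And>S T. S \<in> Pow {..<k} \<Longrightarrow> T \<in> Pow {..<k} \<Longrightarrow>
      card (sym_diff (h S) (h T)) = 1 \<longleftrightarrow> card (sym_diff S T) = 1"
    using iso unfolding digraph_iso_set_graph_iff by blast
  obtain B A where BA: "A \<inter> B = {}" "finite A" "card A = k" "h ` Pow {..<k} = subcube B A"
  proof (rule cube_embedding_image[of h k])
    show "inj_on h (Pow {..<k})" using h by (simp add: bij_betw_def)
    fix S i assume S: "S \<subseteq> {..<k}" "i < k" "i \<notin> S"
    then have "sym_diff S (insert i S) = {i}" by auto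
    then show "card (sym_diff (h S) (h (insert i S))) = 1" using S by (subst adj) auto
  qed blast
  have "subcube B A = W" using h BA(4) by (simp add: bij_betw_def)
  then show "\<exists>B A. A \<inter> B = {} \<and> finite A \<and> card A = k \<and> subcube B A \<subseteq> V \<and>
      Q = set_graph (subcube B A)"
    using W BA by (intro exI[of _ B] exI[of _ A]) simp
next
  assume "\<exists>B A. A \<inter> B = {} \<and> finite A \<and> card A = k \<and> subcube B A \<subseteq> V \<and>
      Q = set_graph (subcube B A)"
  then obtain B A where BA: "A \<inter> B = {}" "finite A" "card A = k" "subcube B A \<subseteq> V"
    and Q: "Q = set_graph (subcube B A)" by blast
  obtain e where e: "bij_betw e {..<k} A"
    unfolding lessThan_atLeast0 using BA(2,3) ex_bij_betw_nat_finite[of A] by blast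
  then have inj: "inj_on e {..<k}" and img: "e ` {..<k} = A" by (auto simp: bij_betw_def)
  have Pow_img: "image e ` Pow {..<k} = Pow A" using img by (rule image_Pow_surj)
  let ?h = "\<lambda>S. B \<union> e ` S"
  \<comment> \<open>The base \<open>B\<close> cancels because it is disjoint from \<open>A\<close>,
    and the injective \<open>e\<close> transports what is left.\<close>
  have diff: "sym_diff (?h S) (?h T) = e ` sym_diff S T" if "S \<subseteq> {..<k}" "T \<subseteq> {..<k}" for S T
  proof -
    have "e ` S \<subseteq> A" "e ` T \<subseteq> A" using that img by auto
    then have "sym_diff (?h S) (?h T) = sym_diff (e ` S) (e ` T)" using BA(1) by blast
    also have "\<dots> = e ` sym_diff S T"
      using that by (simp add: image_Un inj_on_image_set_diff[OF inj] Diff_subset[THEN subset_trans])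
    finally show ?thesis .
  qed
  have card: "card (sym_diff (?h S) (?h T)) = card (sym_diff S T)"
    if "S \<subseteq> {..<k}" "T \<subseteq> {..<k}" for S T
    unfolding diff[OF that] by (rule card_image, rule inj_on_subset[OF inj]) (use that in blast)
  have "inj_on ?h (Pow {..<k})"
  proof (rule inj_onI)
    fix S T assume ST: "S \<in> Pow {..<k}" "T \<in> Pow {..<k}" "?h S = ?h T"
    then have "e ` sym_diff S T = {}" using diff[of S T] by auto
    then show "S = T" by auto
  qed
  moreover have "?h ` Pow {..<k} = subcube B A"
    unfolding subcube_def Pow_img[symmetric] by (simp add: image_image)
  ultimately have "bij_betw ?h (Pow {..<k}) (subcube B A)" by (simp add: bij_betw_def)
  then have "digraph_iso (with_proj (hypercube k)) (with_proj Q)"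
    unfolding Q hypercube_eq_set_graph digraph_iso_set_graph_iff using card by (intro exI[of _ ?h]) auto
  then show "induced_cube (set_graph V) k Q"
    using BA(4) Q by (auto simp: induced_cube_def induced_subgraph_set_graph_iff)
qed

text \<open>It suffices to compare the least and greatest members, which are \<open>B\<close> and
  \<open>B \<union> A\<close>.\<close>

lemma subcube_subset_iff: 
  assumes "A \<inter> B = {}" "A' \<inter> B' = {}"
  shows "subcube B A \<subseteq> subcube B' A' \<longleftrightarrow> B' \<subseteq> B \<and> B \<union> A \<subseteq> B' \<union> A'"
proof
  assume "subcube B A \<subseteq> subcube B' A'"
  moreover have "B \<in> subcube B A" "B \<union> A \<in> subcube B A" by (auto simp: subcube_def)
  ultimately have "B \<in> subcube B' A'" "B \<union> A \<in> subcube B' A'" by blast+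
  then show "B' \<subseteq> B \<and> B \<union> A \<subseteq> B' \<union> A'" by (auto simp: subcube_def)
next
  assume "B' \<subseteq> B \<and> B \<union> A \<subseteq> B' \<union> A'"
  then have "S \<in> subcube B' A'" if "S \<in> subcube B A" for S
    using that unfolding subcube_def by (intro image_eqI[of _ _ "S - B'"]) auto
  then show "subcube B A \<subseteq> subcube B' A'" by blast
qed

section \<open>Labelings of the fence\<close>

text \<open>The generating relations without their closure: being an up-set can be tested on these
  alone.\<close>

definition sfence_arcs :: "nat \<Rightarrow> (nat \<times> nat) set" where
  "sfence_arcs n = Restr sfence_covers {1..n}"

lemma sfence_arcsD: "(a, b) \<in> sfence_arcs n \<Longrightarrow> a \<in> {1..n} \<and> b \<in> {1..n} \<and> a \<noteq> b"
  by (auto simp: sfence_arcs_def sfence_covers_def)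

lemma sfence_filters_iff:
  "F \<in> sfence_filters n \<longleftrightarrow> F \<subseteq> {1..n} \<and> (\<forall>(a, b) \<in> sfence_arcs n. a \<in> F \<longrightarrow> b \<in> F)"
proof -
  have "b \<in> F" if "(a, b) \<in> (sfence_arcs n)\<^sup>*" "\<forall>(a, b) \<in> sfence_arcs n. a \<in> F \<longrightarrow> b \<in> F" "a \<in> F" for a b
    using that by (induction rule: rtrancl_induct) auto
  then show ?thesis
    unfolding sfence_filters_def sfence_le_def sfence_arcs_def[symmetric] by blast
qed

text \<open>A labeling encodes the subcube spanned by the filters \<open>{i. f i = In} \<union> S\<close> with
  \<open>S \<subseteq> {i. f i = Free}\<close>.\<close>

datatype label = Out | Free | In

text \<open>\<open>Free\<close> counts as possibly present at the lower end of an arc and as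
  possibly absent at the upper end, since free elements vary independently. \<open>Out\<close>
  beyond the fence keeps all members inside \<open>{1..n}\<close>.\<close>

definition cube_labeling :: "nat \<Rightarrow> (nat \<Rightarrow> label) \<Rightarrow> bool" where
  "cube_labeling n f \<longleftrightarrow>
     (\<forall>(a, b) \<in> sfence_arcs n. f a \<noteq> Out \<longrightarrow> f b = In) \<and> (\<forall>i. i \<notin> {1..n} \<longrightarrow> f i = Out)"

definition labeled_cube :: "(nat \<Rightarrow> label) \<Rightarrow> nat set set" where
  "labeled_cube f = subcube {i. f i = In} {i. f i = Free}"

definition free_count :: "(nat \<Rightarrow> label) \<Rightarrow> nat" where
  "free_count f = card {i. f i = Free}"

lemma label_neq_Out: "l \<noteq> Out \<longleftrightarrow> l = Free \<or> l = In"
  by (cases l) auto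

lemma labeled_cube_subset_iff:
  "labeled_cube f \<subseteq> labeled_cube g \<longleftrightarrow>
     (\<forall>i. g i = In \<longrightarrow> f i = In) \<and> (\<forall>i. f i \<noteq> Out \<longrightarrow> g i \<noteq> Out)"
proof -
  have "labeled_cube f \<subseteq> labeled_cube g \<longleftrightarrow> {i. g i = In} \<subseteq> {i. f i = In} \<and>
      {i. f i = In} \<union> {i. f i = Free} \<subseteq> {i. g i = In} \<union> {i. g i = Free}"
    unfolding labeled_cube_def by (rule subcube_subset_iff) auto
  then show ?thesis by (auto simp: label_neq_Out)
qed

text \<open>Mutual inclusion fixes the \<open>In\<close> vertices and the \<open>Out\<close>
  vertices, hence every label.\<close>

lemma labeled_cube_inject: "labeled_cube f = labeled_cube g \<longleftrightarrow> f = g"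
proof
  assume "labeled_cube f = labeled_cube g"
  then have "labeled_cube f \<subseteq> labeled_cube g" "labeled_cube g \<subseteq> labeled_cube f" by auto
  then show "f = g"
    unfolding labeled_cube_subset_iff by (intro ext) (metis label.exhaust)
qed simp

lemma labeled_cube_subset_filters_iff:
  "labeled_cube f \<subseteq> sfence_filters n \<longleftrightarrow> cube_labeling n f"
proof
  assume L: "labeled_cube f \<subseteq> sfence_filters n"
  have F: "{i. f i = In} \<union> S \<in> sfence_filters n" if "S \<subseteq> {i. f i = Free}" for S
    using L that by (auto simp: labeled_cube_def subcube_def)
  \<comment> \<open>One member of the cube tests the arc: the base if \<open>f a = In\<close>, and
    the base with \<open>a\<close> added if \<open>f a = Free\<close>; as
    \<open>b \<noteq> a\<close>, membership of \<open>b\<close> means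
    \<open>f b = In\<close>.\<close>
  have "f b = In" if ab: "(a, b) \<in> sfence_arcs n" and "f a \<noteq> Out" for a b
  proof (cases "f a = In")
    case True
    then show ?thesis using F[of "{}"] ab by (auto simp: sfence_filters_iff)
  next
    case False
    then have "b \<in> {i. f i = In} \<union> {a}"
      using F[of "{a}"] ab that(2) by (auto simp: sfence_filters_iff label_neq_Out)
    then show ?thesis using sfence_arcsD[OF ab] by auto
  qed
  moreover have "f i = Out" if "i \<notin> {1..n}" for i
  proof -
    have "{i. f i = In} \<union> {i. f i = Free} \<subseteq> {1..n}"
      using F[of "{i. f i = Free}"] unfolding sfence_filters_iff by simp
    then show ?thesis using that by (cases "f i") auto
  qed
  ultimately show "cube_labeling n f" by (auto simp: cube_labeling_def)
next
  assume f: "cube_labeling n f"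
  have "{i. f i = In} \<union> S \<in> sfence_filters n" if "S \<subseteq> {i. f i = Free}" for S
  proof -
    have "f i \<noteq> Out" if "i \<in> {i. f i = In} \<union> S" for i
      using that \<open>S \<subseteq> _\<close> by auto
    then show ?thesis using f unfolding sfence_filters_iff cube_labeling_def by fast
  qed
  then show "labeled_cube f \<subseteq> sfence_filters n" by (auto simp: labeled_cube_def subcube_def)
qed

lemma induced_cube_Phi_iff:
  "induced_cube (Phi n) k Q \<longleftrightarrow>
     (\<exists>f. cube_labeling n f \<and> free_count f = k \<and> Q = set_graph (labeled_cube f))"
proof
  assume "induced_cube (Phi n) k Q"
  then obtain B A where BA: "A \<inter> B = {}" "card A = k" "subcube B A \<subseteq> sfence_filters n"
      "Q = set_graph (subcube B A)"
    unfolding Phi_eq_set_graph induced_cube_set_graph_iff by blast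
  let ?f = "\<lambda>i. if i \<in> B then In else if i \<in> A then Free else Out"
  have free: "{i. ?f i = Free} = A" and "{i. ?f i = In} = B" using BA(1) by auto
  then have cube: "labeled_cube ?f = subcube B A" by (simp add: labeled_cube_def)
  have "cube_labeling n ?f"
    using BA(3) unfolding cube[symmetric] by (simp only: labeled_cube_subset_filters_iff)
  then show "\<exists>f. cube_labeling n f \<and> free_count f = k \<and> Q = set_graph (labeled_cube f)"
    using BA cube free unfolding free_count_def by (intro exI[of _ ?f]) simp
next
  assume "\<exists>f. cube_labeling n f \<and> free_count f = k \<and> Q = set_graph (labeled_cube f)"
  then obtain f where f: "cube_labeling n f" "card {i. f i = Free} = k"
      "Q = set_graph (subcube {i. f i = In} {i. f i = Free})"
    unfolding free_count_def labeled_cube_def by blast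
  have "{i. f i = Free} \<subseteq> {1..n}" using f(1) by (auto simp: cube_labeling_def)
  then have "finite {i. f i = Free}" by (rule finite_subset) simp
  moreover have "subcube {i. f i = In} {i. f i = Free} \<subseteq> sfence_filters n"
    using f(1) unfolding labeled_cube_def[symmetric] labeled_cube_subset_filters_iff .
  moreover have "{i. f i = Free} \<inter> {i. f i = In} = {}" by auto
  ultimately show "induced_cube (Phi n) k Q"
    unfolding Phi_eq_set_graph induced_cube_set_graph_iff using f(2,3) by blast
qed

text \<open>An \<open>Out\<close> vertex all of whose upper covers are \<open>In\<close>, or an \<open>In\<close> vertex all of whose lower
  covers are \<open>Out\<close>, could be relabeled \<open>Free\<close>; maximality of the cube means that there is none.\<close>

definition maximal_on :: "('a \<times> 'a) set \<Rightarrow> 'a set \<Rightarrow> ('a \<Rightarrow> label) \<Rightarrow> bool" where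
  "maximal_on R V f \<longleftrightarrow>
     (\<forall>(a, b) \<in> R. f a \<noteq> Out \<longrightarrow> f b = In) \<and>
     (\<forall>i \<in> V. f i = Out \<longrightarrow> (\<exists>b. (i, b) \<in> R \<and> f b \<noteq> In)) \<and>
     (\<forall>i \<in> V. f i = In \<longrightarrow> (\<exists>a. (a, i) \<in> R \<and> f a \<noteq> Out))"

definition maximal_labelings :: "nat \<Rightarrow> (nat \<Rightarrow> label) set" where
  "maximal_labelings n =
     {f. maximal_on (sfence_arcs n) {1..n} f \<and> (\<forall>i. i \<notin> {1..n} \<longrightarrow> f i = Out)}"

section \<open>Maximal cubes as maximal labelings\<close>

lemma maximal_labelings_imp_cube_labeling:
  "f \<in> maximal_labelings n \<Longrightarrow> cube_labeling n f"
  by (auto simp: maximal_labelings_def maximal_on_def cube_labeling_def)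

lemma finite_Free: "cube_labeling n f \<Longrightarrow> finite {i. f i = Free}"
  by (rule finite_subset[of _ "{1..n}"]) (auto simp: cube_labeling_def)

text \<open>A vertex that could become \<open>Free\<close> would give a cube of one dimension more.
  Conversely, the local conditions force the \<open>Free\<close> vertices of any \<open>g\<close>
  whose cube contains that of \<open>f\<close> to be \<open>Free\<close> in \<open>f\<close>, so the
  dimension cannot grow.\<close>

lemma maximal_cube_Phi_iff:
  "maximal_cube (Phi n) k Q \<longleftrightarrow>
     (\<exists>f \<in> maximal_labelings n. free_count f = k \<and> Q = set_graph (labeled_cube f))"
proof
  assume max: "maximal_cube (Phi n) k Q"
  then obtain f where f: "cube_labeling n f" "free_count f = k" "Q = set_graph (labeled_cube f)"
    by (auto simp: maximal_cube_def induced_cube_Phi_iff)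
  have not_larger: False
    if g: "cube_labeling n (f(i := Free))" and i: "f i \<noteq> Free" for i
  proof -
    have "{j. (f(i := Free)) j = Free} = insert i {j. f j = Free}" by auto
    then have "free_count (f(i := Free)) = Suc k"
      using f(2) i finite_Free[OF f(1)] by (simp add: free_count_def)
    then have "induced_cube (Phi n) (Suc k) (set_graph (labeled_cube (f(i := Free))))"
      using g induced_cube_Phi_iff by blast
    moreover have "labeled_cube f \<subseteq> labeled_cube (f(i := Free))"
      by (auto simp: labeled_cube_subset_iff)
    then have "subgraph (with_proj Q) (with_proj (set_graph (labeled_cube (f(i := Free)))))"
      using f(3) by (simp add: subgraph_set_graph_iff)
    ultimately show False using max unfolding maximal_cube_def by blast
  qed
  have lab: "\<And>a b. (a, b) \<in> sfence_arcs n \<Longrightarrow> f a \<noteq> Out \<Longrightarrow> f b = In"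
    and out: "\<And>i. i \<notin> {1..n} \<Longrightarrow> f i = Out"
    using f(1) by (auto simp: cube_labeling_def)
  have "\<exists>b. (i, b) \<in> sfence_arcs n \<and> f b \<noteq> In" if "i \<in> {1..n}" "f i = Out" for i
  proof (rule ccontr)
    assume no: "\<nexists>b. (i, b) \<in> sfence_arcs n \<and> f b \<noteq> In"
    \<comment> \<open>Arcs into \<open>i\<close> start at \<open>Out\<close> vertices because
      \<open>f i\<close> is not \<open>In\<close>; arcs out of \<open>i\<close> end at
      \<open>In\<close> vertices by \<open>no\<close>.\<close>
    have "(f(i := Free)) b = In" if "(a, b) \<in> sfence_arcs n" "(f(i := Free)) a \<noteq> Out" for a b
      using that no lab[of a b] sfence_arcsD[of a b n] \<open>f i = Out\<close> by (auto split: if_splits)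
    then have "\<forall>(a, b) \<in> sfence_arcs n. (f(i := Free)) a \<noteq> Out \<longrightarrow> (f(i := Free)) b = In"
      by blast
    moreover have "\<forall>j. j \<notin> {1..n} \<longrightarrow> (f(i := Free)) j = Out"
      using out \<open>i \<in> {1..n}\<close> by auto
    ultimately have "cube_labeling n (f(i := Free))"
      unfolding cube_labeling_def by (rule conjI)
    then show False using not_larger[of i] \<open>f i = Out\<close> by simp
  qed
  moreover have "\<exists>a. (a, i) \<in> sfence_arcs n \<and> f a \<noteq> Out" if "i \<in> {1..n}" "f i = In" for i
  proof (rule ccontr)
    assume no: "\<nexists>a. (a, i) \<in> sfence_arcs n \<and> f a \<noteq> Out"
    \<comment> \<open>Dually, arcs out of \<open>i\<close> end at \<open>In\<close> vertices because
      \<open>f i = In\<close>; arcs into \<open>i\<close> start at \<open>Out\<close> vertices by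
      \<open>no\<close>.\<close>
    have "(f(i := Free)) b = In" if "(a, b) \<in> sfence_arcs n" "(f(i := Free)) a \<noteq> Out" for a b
      using that no lab[of a b] sfence_arcsD[of a b n] \<open>f i = In\<close> by (auto split: if_splits)
    then have "\<forall>(a, b) \<in> sfence_arcs n. (f(i := Free)) a \<noteq> Out \<longrightarrow> (f(i := Free)) b = In"
      by blast
    moreover have "\<forall>j. j \<notin> {1..n} \<longrightarrow> (f(i := Free)) j = Out"
      using out \<open>i \<in> {1..n}\<close> by auto
    ultimately have "cube_labeling n (f(i := Free))"
      unfolding cube_labeling_def by (rule conjI)
    then show False using not_larger[of i] \<open>f i = In\<close> by simp
  qed
  ultimately have "f \<in> maximal_labelings n"
    using lab out by (auto simp: maximal_labelings_def maximal_on_def)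
  then show "\<exists>f \<in> maximal_labelings n. free_count f = k \<and> Q = set_graph (labeled_cube f)"
    using f by blast
next
  assume "\<exists>f \<in> maximal_labelings n. free_count f = k \<and> Q = set_graph (labeled_cube f)"
  then obtain f where f: "f \<in> maximal_labelings n" "free_count f = k"
    and Q: "Q = set_graph (labeled_cube f)" by blast
  have up: "\<And>i. i \<in> {1..n} \<Longrightarrow> f i = Out \<Longrightarrow> \<exists>b. (i, b) \<in> sfence_arcs n \<and> f b \<noteq> In"
    and down: "\<And>i. i \<in> {1..n} \<Longrightarrow> f i = In \<Longrightarrow> \<exists>a. (a, i) \<in> sfence_arcs n \<and> f a \<noteq> Out"
    using f(1) by (auto simp: maximal_labelings_def maximal_on_def)
  have "free_count g \<le> k" if g: "cube_labeling n g" and "labeled_cube f \<subseteq> labeled_cube g" for g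
  proof -
    have sub: "\<And>i. g i = In \<Longrightarrow> f i = In" "\<And>i. f i \<noteq> Out \<Longrightarrow> g i \<noteq> Out"
      using that(2) by (simp_all add: labeled_cube_subset_iff)
    have lab: "\<And>a b. (a, b) \<in> sfence_arcs n \<Longrightarrow> g a \<noteq> Out \<Longrightarrow> g b = In"
      using g by (auto simp: cube_labeling_def)
    \<comment> \<open>If \<open>f i = Out\<close>, some upper cover \<open>b\<close> has
      \<open>f b \<noteq> In\<close>, yet \<open>g b = In\<close> forces \<open>f b = In\<close>. If
      \<open>f i = In\<close>, some lower cover \<open>a\<close> has
      \<open>f a \<noteq> Out\<close>, so \<open>g a \<noteq> Out\<close> and
      \<open>g i = In\<close>.\<close>
    have "f i = Free" if i: "g i = Free" for i
    proof -
      have "i \<in> {1..n}" using g i by (auto simp: cube_labeling_def)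
      then have "f i \<noteq> Out" "f i \<noteq> In"
        using up[of i] down[of i] sub lab i by (metis label.distinct)+
      then show ?thesis by (cases "f i") auto
    qed
    then have "{i. g i = Free} \<subseteq> {i. f i = Free}" by blast
    then show ?thesis
      using f finite_Free maximal_labelings_imp_cube_labeling
      unfolding free_count_def by (metis card_mono)
  qed
  then show "maximal_cube (Phi n) k Q"
    unfolding maximal_cube_def induced_cube_Phi_iff Q
    using f maximal_labelings_imp_cube_labeling by (fastforce simp: subgraph_set_graph_iff)
qed

lemma finite_maximal_labelings: "finite (maximal_labelings n)"
proof (rule finite_subset)
  have "UNIV = {Out, Free, In}" using label.exhaust by blast
  then have "finite (UNIV :: label set)" by (metis finite.emptyI finite.insertI)
  then show "finite {f. \<forall>i. (i \<in> {1..n} \<longrightarrow> f i \<in> (UNIV :: label set)) \<and> (i \<notin> {1..n} \<longrightarrow> f i = Out)}"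
    by (intro finite_set_of_finite_funs) simp_all
qed (auto simp: maximal_labelings_def)

lemma max_cube_count_eq:
  "max_cube_count n k = card {f \<in> maximal_labelings n. free_count f = k}"
proof -
  have "{Q. maximal_cube (Phi n) k Q} =
      (\<lambda>f. set_graph (labeled_cube f)) ` {f \<in> maximal_labelings n. free_count f = k}"
    unfolding maximal_cube_Phi_iff by blast
  moreover have "inj (\<lambda>f. set_graph (labeled_cube f))"
    by (rule injI) (metis pverts_set_graph labeled_cube_inject)
  ultimately show ?thesis
    unfolding max_cube_count_def by (simp add: card_image inj_on_subset)
qed

text \<open>Replaces counting by dimension with a weighted sum over labelings, which bijections can
  reindex.\<close>

lemma max_cube_poly_eq:
  "max_cube_poly n = (\<Sum>f \<in> maximal_labelings n. monom 1 (free_count f))"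
proof (rule poly_eqI)
  fix k
  have "coeff (\<Sum>f \<in> maximal_labelings n. monom (1::int) (free_count f)) k =
      (\<Sum>f \<in> maximal_labelings n. if free_count f = k then 1 else 0)"
    by (simp add: coeff_sum)
  also have "\<dots> = int (max_cube_count n k)"
    using finite_maximal_labelings by (simp add: max_cube_count_eq sum.If_cases Int_def)
  finally show "coeff (max_cube_poly n) k =
      coeff (\<Sum>f \<in> maximal_labelings n. monom 1 (free_count f)) k"
    by (simp add: coeff_max_cube_poly)
qed

section \<open>The recurrence\<close>

lemma maximal_on_cong:
  assumes "R \<subseteq> V \<times> V" "\<And>i. i \<in> V \<Longrightarrow> f i = g i"
  shows "maximal_on R V f \<longleftrightarrow> maximal_on R V g"
proof -
  have "(a, b) \<in> R \<Longrightarrow> f a = g a \<and> f b = g b" for a b using assms by auto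
  then show ?thesis using assms(2) unfolding maximal_on_def by (smt (verit) case_prodD case_prodI2)
qed

text \<open>If the new endpoint of every arc leaving \<open>V\<close> has a label that imposes no condition on the
  old endpoint, then maximality on \<open>V\<close> and on the new part are independent.\<close>

lemma maximal_on_Un_iff:
  assumes "R \<subseteq> V \<times> V" "V \<inter> W = {}"
    and "\<And>a b. (a, b) \<in> E \<Longrightarrow> a \<in> V \<Longrightarrow> b \<in> W \<and> f b = In"
    and "\<And>a b. (a, b) \<in> E \<Longrightarrow> b \<in> V \<Longrightarrow> a \<in> W \<and> f a = Out"
  shows "maximal_on (R \<union> E) (V \<union> W) f \<longleftrightarrow> maximal_on R V f \<and> maximal_on E W f"
proof -
  have R: "(a, b) \<in> R \<Longrightarrow> a \<in> V \<and> b \<in> V \<and> a \<notin> W \<and> b \<notin> W" for a b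
    using assms(1,2) by auto
  \<comment> \<open>An arc of \<open>E\<close> at a vertex of \<open>V\<close> is never a witness,
    because of the label assumed at its other end.\<close>
  have "(\<exists>b. (i, b) \<in> R \<union> E \<and> f b \<noteq> In) \<longleftrightarrow> (\<exists>b. (i, b) \<in> R \<and> f b \<noteq> In)"
    "(\<exists>a. (a, i) \<in> R \<union> E \<and> f a \<noteq> Out) \<longleftrightarrow> (\<exists>a. (a, i) \<in> R \<and> f a \<noteq> Out)" if "i \<in> V" for i
    using assms(3)[of i] assms(4)[of _ i] that by blast+
  moreover have "(\<exists>b. (i, b) \<in> R \<union> E \<and> f b \<noteq> In) \<longleftrightarrow> (\<exists>b. (i, b) \<in> E \<and> f b \<noteq> In)"
    "(\<exists>a. (a, i) \<in> R \<union> E \<and> f a \<noteq> Out) \<longleftrightarrow> (\<exists>a. (a, i) \<in> E \<and> f a \<noteq> Out)" if "i \<in> W" for i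
    using R that by blast+
  ultimately show ?thesis unfolding maximal_on_def ball_Un by (auto simp: ball_Un)
qed

section \<open>Growth of the fence and removal of its last vertices\<close>

lemma sfence_arcs_subset: "sfence_arcs n \<subseteq> {1..n} \<times> {1..n}"
  by (auto simp: sfence_arcs_def)

text \<open>Parity and order replace the index \<open>i\<close>, so that covers can be decided by
  arithmetic.\<close>

lemma mem_sfence_covers_iff:
  "(a, b) \<in> sfence_covers \<longleftrightarrow> (a, b) \<in> {(2, 1), (3, 2), (2, 4), (5, 4)} \<or>
     6 \<le> b \<and> even b \<and> (b = Suc a \<or> a = Suc b)"
proof -
  have "(\<exists>i\<ge>3. a = 2 * i - 1 \<and> b = 2 * i) \<longleftrightarrow> 6 \<le> b \<and> even b \<and> b = Suc a"
    "(\<exists>i\<ge>3. a = 2 * i + 1 \<and> b = 2 * i) \<longleftrightarrow> 6 \<le> b \<and> even b \<and> a = Suc b"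
    by presburger+
  then show ?thesis unfolding sfence_covers_def by blast
qed

text \<open>From vertex 5 on, each new vertex is joined only to its predecessor, the even one being
  on top. Vertex 4 is joined to 2 instead of 3, whence the bound.\<close>

lemma sfence_arcs_Suc:
  assumes "4 \<le> n"
  shows "sfence_arcs (Suc n) = insert (if even n then (Suc n, n) else (n, Suc n)) (sfence_arcs n)"
proof -
  have "(a, b) \<in> sfence_arcs (Suc n) \<longleftrightarrow>
      (a, b) = (if even n then (Suc n, n) else (n, Suc n)) \<or> (a, b) \<in> sfence_arcs n" for a b
    using assms unfolding sfence_arcs_def
    by (cases "n = 4"; cases "a = Suc n"; cases "b = Suc n"; auto simp: mem_sfence_covers_iff)
  then show ?thesis by auto
qed

lemma sfence_arcs_4: "sfence_arcs 4 = insert (2, 4) (sfence_arcs 3)"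
  unfolding sfence_arcs_def by (auto simp: mem_sfence_covers_iff)

text \<open>The label forced on a vertex next to a \<open>Free\<close> one, away from the irregular part of the
  fence: even vertices are maximal and odd ones minimal.\<close>

definition dominated :: "nat \<Rightarrow> label" where
  "dominated i = (if even i then In else Out)"

lemma dominated_neq_Free [simp]: "dominated i \<noteq> Free"
  by (simp add: dominated_def)

lemma maximal_on_upd_above:
  assumes "n < m"
  shows "maximal_on (sfence_arcs n) {Suc 0..n} (f(m := l)) \<longleftrightarrow>
    maximal_on (sfence_arcs n) {Suc 0..n} f"
  using assms sfence_arcs_subset[of n] by (intro maximal_on_cong) auto

text \<open>A \<open>Free\<close> last vertex forces the label of \<open>n + 1\<close>, and that
  label puts no condition on \<open>n\<close>. So the last two vertices split off.\<close>

lemma maximal_labelings_add_2: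
  assumes "4 \<le> n"
  shows "{f \<in> maximal_labelings (n + 2). f (n + 2) = Free} =
    (\<lambda>f. f(n + 1 := dominated (n + 1), n + 2 := Free)) ` maximal_labelings n"
    (is "_ = ?ext ` _")
proof -
  let ?W = "{n + 1, n + 2}"
  \<comment> \<open>Vertex \<open>n + 1\<close> lies below both neighbours if \<open>n\<close> is
    even and above both if \<open>n\<close> is odd.\<close>
  define E where "E = (if even n then {(n + 1, n), (n + 1, n + 2)} else {(n, n + 1), (n + 2, n + 1)})"
  have arcs: "sfence_arcs (n + 2) = sfence_arcs n \<union> E"
    using assms by (auto simp: sfence_arcs_Suc E_def)
  have V: "{1..n + 2} = {1..n} \<union> ?W" by auto
  have split: "maximal_on (sfence_arcs (n + 2)) {1..n + 2} f \<longleftrightarrow> maximal_on (sfence_arcs n) {1..n} f"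
    if "f (n + 1) = dominated (n + 1)" "f (n + 2) = Free" for f
  proof -
    \<comment> \<open>The \<open>Free\<close> neighbour \<open>n + 2\<close> is the witness that
      \<open>n + 1\<close> cannot be relabeled.\<close>
    have "maximal_on E ?W f"
      using that by (auto simp: maximal_on_def E_def dominated_def)
    moreover have "maximal_on (sfence_arcs (n + 2)) {1..n + 2} f \<longleftrightarrow>
        maximal_on (sfence_arcs n) {1..n} f \<and> maximal_on E ?W f"
      unfolding arcs V using that
      by (intro maximal_on_Un_iff sfence_arcs_subset)
        (auto simp: E_def dominated_def split: if_splits)
    ultimately show ?thesis by blast
  qed
  show ?thesis
  proof (intro equalityI subsetI)
    fix f assume "f \<in> {f \<in> maximal_labelings (n + 2). f (n + 2) = Free}"
    then have f: "maximal_on (sfence_arcs (n + 2)) {1..n + 2} f" "\<And>i. i \<notin> {1..n + 2} \<Longrightarrow> f i = Out"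
      "f (n + 2) = Free" by (auto simp: maximal_labelings_def)
    have lab: "\<And>a b. (a, b) \<in> E \<Longrightarrow> f a \<noteq> Out \<Longrightarrow> f b = In"
      using f(1) unfolding maximal_on_def arcs by blast
    \<comment> \<open>A \<open>Free\<close> upper end forces the lower end to be \<open>Out\<close>;
      a \<open>Free\<close> lower end forces the upper end to be \<open>In\<close>.\<close>
    have dom: "f (n + 1) = dominated (n + 1)"
      using lab[of "n + 1" "n + 2"] lab[of "n + 2" "n + 1"] f(3)
      by (cases "even n"; cases "f (n + 1)") (auto simp: E_def dominated_def)
    define g where "g = f(n + 1 := Out, n + 2 := Out)"
    have "g \<in> maximal_labelings n"
      using f dom split[of f] by (auto simp: g_def maximal_labelings_def maximal_on_upd_above)
    moreover have "f i = (g(n + 1 := dominated (n + 1), n + 2 := Free)) i" for i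
      using f(3) dom by (simp add: g_def)
    then have "f = g(n + 1 := dominated (n + 1), n + 2 := Free)" by (rule ext)
    ultimately show "f \<in> ?ext ` maximal_labelings n"
      by (rule rev_image_eqI[where f = ?ext])
  next
    fix f' assume "f' \<in> ?ext ` maximal_labelings n"
    then obtain f where f: "f \<in> maximal_labelings n" and f': "f' = ?ext f" by blast
    have "maximal_on (sfence_arcs n) {1..n} f'"
      using f by (simp add: f' maximal_labelings_def maximal_on_upd_above)
    then have "maximal_on (sfence_arcs (n + 2)) {1..n + 2} f'"
      by (subst split) (simp_all add: f')
    then show "f' \<in> {f \<in> maximal_labelings (n + 2). f (n + 2) = Free}"
      using f by (auto simp: f' maximal_labelings_def)
  qed
qed

text \<open>From vertex 5 on, even vertices have no upper cover and so are not \<open>Out\<close>,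
  while odd ones have no lower cover and so are not \<open>In\<close>. A last vertex that is not
  \<open>Free\<close> needs its only neighbour as a witness, and \<open>Free\<close> is the one
  label of \<open>n + 2\<close> that serves.\<close>

lemma maximal_labelings_last:
  assumes f: "f \<in> maximal_labelings (n + 3)" and "3 \<le> n" and "f (n + 3) \<noteq> Free"
  shows "f (n + 3) = dominated (n + 3)" "f (n + 2) = Free"
proof -
  have up: "\<And>i. i \<in> {1..n + 3} \<Longrightarrow> f i = Out \<Longrightarrow> \<exists>b. (i, b) \<in> sfence_arcs (n + 3) \<and> f b \<noteq> In"
    and down: "\<And>i. i \<in> {1..n + 3} \<Longrightarrow> f i = In \<Longrightarrow> \<exists>a. (a, i) \<in> sfence_arcs (n + 3) \<and> f a \<noteq> Out"
    using f by (auto simp: maximal_labelings_def maximal_on_def)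
  have "f (n + 3) = dominated (n + 3) \<and> f (n + 2) = Free"
  proof (cases "even (n + 3)")
    case True
    have "f (n + 3) \<noteq> Out"
      using up[of "n + 3"] True by (auto simp: sfence_arcs_def mem_sfence_covers_iff)
    then have In: "f (n + 3) = In" using assms(3) by (cases "f (n + 3)") auto
    have "f (n + 2) \<noteq> Out"
      using down[of "n + 3"] In \<open>3 \<le> n\<close> by (auto simp: sfence_arcs_def mem_sfence_covers_iff)
    moreover have "f (n + 2) \<noteq> In"
      using down[of "n + 2"] True \<open>3 \<le> n\<close> by (auto simp: sfence_arcs_def mem_sfence_covers_iff)
    ultimately show ?thesis using In True by (cases "f (n + 2)") (auto simp: dominated_def)
  next
    case False
    have "f (n + 3) \<noteq> In"
      using down[of "n + 3"] False \<open>3 \<le> n\<close> by (auto simp: sfence_arcs_def mem_sfence_covers_iff)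
    then have Out: "f (n + 3) = Out" using assms(3) by (cases "f (n + 3)") auto
    have "f (n + 2) \<noteq> In"
      using up[of "n + 3"] Out \<open>3 \<le> n\<close> by (auto simp: sfence_arcs_def mem_sfence_covers_iff)
    moreover have "f (n + 2) \<noteq> Out"
      using up[of "n + 2"] False \<open>3 \<le> n\<close> by (auto simp: sfence_arcs_def mem_sfence_covers_iff)
    ultimately show ?thesis using Out False by (cases "f (n + 2)") (auto simp: dominated_def)
  qed
  then show "f (n + 3) = dominated (n + 3)" "f (n + 2) = Free" by simp_all
qed

text \<open>All three last labels are forced, and the label of \<open>n + 1\<close> again puts no
  condition on the remaining fence.\<close>

lemma maximal_labelings_add_3:
  assumes "3 \<le> n"
  shows "{f \<in> maximal_labelings (n + 3). f (n + 3) \<noteq> Free} =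
    (\<lambda>f. f(n + 1 := dominated (n + 1), n + 2 := Free, n + 3 := dominated (n + 3))) `
      maximal_labelings n" (is "_ = ?ext ` _")
proof -
  let ?W = "{n + 1, n + 2, n + 3}"
  \<comment> \<open>For \<open>n = 3\<close> vertex 4 hangs above 2 instead of 3; its label
    \<open>In\<close> makes this attachment harmless as well.\<close>
  define E where "E = (if n = 3 then {(2, 4), (5, 4), (5, 6)}
    else if even n then {(n + 1, n), (n + 1, n + 2), (n + 3, n + 2)}
    else {(n, n + 1), (n + 2, n + 1), (n + 2, n + 3)})"
  have arcs: "sfence_arcs (n + 3) = sfence_arcs n \<union> E"
  proof (cases "n = 3")
    case True
    have "sfence_arcs 6 = insert (5, 6) (insert (5, 4) (insert (2, 4) (sfence_arcs 3)))"
      using sfence_arcs_Suc[of 4] sfence_arcs_Suc[of 5] sfence_arcs_4 by simp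
    then have "sfence_arcs 6 = sfence_arcs 3 \<union> {(2, 4), (5, 4), (5, 6)}" by auto
    then show ?thesis using True by (simp add: E_def)
  next
    case False
    have "sfence_arcs (n + 3) = sfence_arcs (Suc (Suc (Suc n)))" by (simp add: numeral_3_eq_3)
    then show ?thesis using assms False by (auto simp: sfence_arcs_Suc E_def)
  qed
  have V: "{1..n + 3} = {1..n} \<union> ?W" by auto
  have split: "maximal_on (sfence_arcs (n + 3)) {1..n + 3} f \<longleftrightarrow> maximal_on (sfence_arcs n) {1..n} f"
    if "f (n + 1) = dominated (n + 1)" "f (n + 2) = Free" "f (n + 3) = dominated (n + 3)" for f
  proof -
    have "maximal_on E ?W f"
      using that by (auto simp: maximal_on_def E_def dominated_def)
    moreover have "maximal_on (sfence_arcs (n + 3)) {1..n + 3} f \<longleftrightarrow>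
        maximal_on (sfence_arcs n) {1..n} f \<and> maximal_on E ?W f"
      unfolding arcs V using that
      by (intro maximal_on_Un_iff sfence_arcs_subset)
        (auto simp: E_def dominated_def split: if_splits)
    ultimately show ?thesis by blast
  qed
  show ?thesis
  proof (intro equalityI subsetI)
    fix f assume mem: "f \<in> {f \<in> maximal_labelings (n + 3). f (n + 3) \<noteq> Free}"
    then have f: "maximal_on (sfence_arcs (n + 3)) {1..n + 3} f" "\<And>i. i \<notin> {1..n + 3} \<Longrightarrow> f i = Out"
      by (auto simp: maximal_labelings_def)
    have f3: "f (n + 3) = dominated (n + 3)" and f2: "f (n + 2) = Free"
      using mem assms maximal_labelings_last by blast+
    have lab: "\<And>a b. (a, b) \<in> E \<Longrightarrow> f a \<noteq> Out \<Longrightarrow> f b = In"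
      using f(1) unfolding maximal_on_def arcs by blast
    have f1: "f (n + 1) = dominated (n + 1)"
      using lab[of "n + 1" "n + 2"] lab[of "n + 2" "n + 1"] f2
      by (cases "n = 3"; cases "even n"; cases "f (n + 1)") (auto simp: E_def dominated_def split: if_splits)
    define g where "g = f(n + 1 := Out, n + 2 := Out, n + 3 := Out)"
    have "g \<in> maximal_labelings n"
      using f f1 f2 f3 split[of f] by (auto simp: g_def maximal_labelings_def maximal_on_upd_above)
    moreover have "f i = ?ext g i" for i
      using f1 f2 f3 by (simp add: g_def)
    then have "f = ?ext g" by (rule ext)
    ultimately show "f \<in> ?ext ` maximal_labelings n"
      by (rule rev_image_eqI[where f = ?ext])
  next
    fix f' assume "f' \<in> ?ext ` maximal_labelings n"
    then obtain f where f: "f \<in> maximal_labelings n" and f': "f' = ?ext f" by blast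
    have "maximal_on (sfence_arcs n) {1..n} f'"
      using f by (simp add: f' maximal_labelings_def maximal_on_upd_above)
    then have "maximal_on (sfence_arcs (n + 3)) {1..n + 3} f'"
      by (subst split) (simp_all add: f')
    then show "f' \<in> {f \<in> maximal_labelings (n + 3). f (n + 3) \<noteq> Free}"
      using f by (auto simp: f' maximal_labelings_def)
  qed
qed

lemma finite_Free_maximal: "f \<in> maximal_labelings n \<Longrightarrow> finite {i. f i = Free}"
  using finite_Free maximal_labelings_imp_cube_labeling by blast

lemma maximal_labelings_above: "f \<in> maximal_labelings n \<Longrightarrow> n < i \<Longrightarrow> f i = Out"
  by (auto simp: maximal_labelings_def)

text \<open>The labelings are split by whether the last vertex is \<open>Free\<close>. Either
  extension adds exactly one \<open>Free\<close> vertex, hence the factor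
  \<open>[:0, 1:]\<close>.\<close>

lemma max_cube_poly_rec:
  assumes "3 \<le> n"
  shows "max_cube_poly (n + 3) = [:0, 1:] * (max_cube_poly (n + 1) + max_cube_poly n)"
proof -
  let ?m = "\<lambda>f. monom (1::int) (free_count f)"
  let ?L = "maximal_labelings (n + 3)"
  let ?e1 = "\<lambda>f. f(n + 2 := dominated (n + 2), n + 3 := Free)"
  let ?e2 = "\<lambda>f. f(n + 1 := dominated (n + 1), n + 2 := Free, n + 3 := dominated (n + 3))"
  have sums: "n + 1 + 2 = n + 3" "n + 1 + 1 = n + 2" by simp_all
  have img1: "{f \<in> ?L. f (n + 3) = Free} = ?e1 ` maximal_labelings (n + 1)"
    by (rule maximal_labelings_add_2[of "n + 1", unfolded sums]) (use assms in simp)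
  have img2: "{f \<in> ?L. f (n + 3) \<noteq> Free} = ?e2 ` maximal_labelings n"
    by (rule maximal_labelings_add_3[OF assms])
  \<comment> \<open>The overwritten vertices carry no information, since both labelings are
    \<open>Out\<close> there.\<close>
  have inj1: "inj_on ?e1 (maximal_labelings (n + 1))"
  proof (rule inj_onI, rule ext)
    fix f g i assume fg: "f \<in> maximal_labelings (n + 1)" "g \<in> maximal_labelings (n + 1)" "?e1 f = ?e1 g"
    show "f i = g i"
    proof (cases "n + 1 < i")
      case True then show ?thesis using fg maximal_labelings_above by metis
    next
      case False then show ?thesis using fun_cong[OF fg(3), of i] by (simp split: if_splits)
    qed
  qed
  have inj2: "inj_on ?e2 (maximal_labelings n)"
  proof (rule inj_onI, rule ext)
    fix f g i assume fg: "f \<in> maximal_labelings n" "g \<in> maximal_labelings n" "?e2 f = ?e2 g"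
    show "f i = g i"
    proof (cases "n < i")
      case True then show ?thesis using fg maximal_labelings_above by metis
    next
      case False then show ?thesis using fun_cong[OF fg(3), of i] by (simp split: if_splits)
    qed
  qed
  have m1: "?m (?e1 f) = [:0, 1:] * ?m f" if f: "f \<in> maximal_labelings (n + 1)" for f
  proof -
    have out: "f (n + 2) = Out" "f (n + 3) = Out" using f by (auto simp: maximal_labelings_def)
    then have "{i. ?e1 f i = Free} = insert (n + 3) {i. f i = Free}" by auto
    then have "free_count (?e1 f) = Suc (free_count f)"
      using finite_Free_maximal[OF f] out by (simp add: free_count_def)
    then show ?thesis by (simp only: monom_Suc) simp
  qed
  have m2: "?m (?e2 f) = [:0, 1:] * ?m f" if f: "f \<in> maximal_labelings n" for f
  proof -
    have out: "f (n + 1) = Out" "f (n + 2) = Out" "f (n + 3) = Out"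
      using f by (auto simp: maximal_labelings_def)
    then have "{i. ?e2 f i = Free} = insert (n + 2) {i. f i = Free}" by auto
    then have "free_count (?e2 f) = Suc (free_count f)"
      using finite_Free_maximal[OF f] out by (simp add: free_count_def)
    then show ?thesis by (simp only: monom_Suc) simp
  qed
  have "max_cube_poly (n + 3) = (\<Sum>f \<in> {f \<in> ?L. f (n + 3) = Free}. ?m f)
      + (\<Sum>f \<in> {f \<in> ?L. f (n + 3) \<noteq> Free}. ?m f)"
    unfolding max_cube_poly_eq using finite_maximal_labelings
    by (subst sum.union_disjoint[symmetric]) (auto intro!: sum.cong)
  also have "\<dots> = (\<Sum>f \<in> maximal_labelings (n + 1). ?m (?e1 f))
      + (\<Sum>f \<in> maximal_labelings n. ?m (?e2 f))"
    unfolding img1 img2 sum.reindex[OF inj1] sum.reindex[OF inj2] by simp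
  also have "\<dots> = (\<Sum>f \<in> maximal_labelings (n + 1). [:0, 1:] * ?m f)
      + (\<Sum>f \<in> maximal_labelings n. [:0, 1:] * ?m f)"
    using m1 m2 by (intro arg_cong2[where f = "(+)"] sum.cong) auto
  also have "\<dots> = [:0, 1:] * (max_cube_poly (n + 1) + max_cube_poly n)"
    unfolding max_cube_poly_eq by (simp only: sum_distrib_left[symmetric] distrib_left)
  finally show ?thesis .
qed

section \<open>Small fences and the generating function\<close>

text \<open>Lists make the small cases finite enumerations; vertices are numbered from 1 and list
  positions from 0.\<close>

definition labels :: "label list \<Rightarrow> nat \<Rightarrow> label" where
  "labels ls i = (if i \<in> {1..length ls} then ls ! (i - 1) else Out)"

lemma labels_inject:
  assumes "length xs = length ys"
  shows "labels xs = labels ys \<longleftrightarrow> xs = ys"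
proof
  assume eq: "labels xs = labels ys"
  show "xs = ys"
  proof (rule nth_equalityI[OF assms])
    fix i assume "i < length xs"
    then show "xs ! i = ys ! i"
      using fun_cong[OF eq, of "Suc i"] assms by (simp add: labels_def)
  qed
qed simp

lemma free_count_labels: "free_count (labels ls) = length (filter (\<lambda>l. l = Free) ls)"
proof -
  have "{i. labels ls i = Free} = Suc ` {i. i < length ls \<and> ls ! i = Free}"
  proof (intro equalityI subsetI)
    fix i assume i: "i \<in> {i. labels ls i = Free}"
    then show "i \<in> Suc ` {i. i < length ls \<and> ls ! i = Free}"
      by (intro image_eqI[of _ _ "i - 1"]) (auto simp: labels_def split: if_splits)
  qed (auto simp: labels_def)
  then show ?thesis
    by (simp add: free_count_def card_image length_filter_conv_card)
qed

lemma sfence_arcs_le_5: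
  assumes "n \<le> 5"
  shows "sfence_arcs n = {(2, 1), (3, 2), (2, 4), (5, 4)} \<inter> {1..n} \<times> {1..n}"
  using assms unfolding sfence_arcs_def by (auto simp: mem_sfence_covers_iff)

lemma sfence_arcs_small:
  "sfence_arcs 0 = {}" "sfence_arcs 1 = {}" "sfence_arcs 2 = {(2, 1)}"
  "sfence_arcs 3 = {(2, 1), (3, 2)}" "sfence_arcs 4 = {(2, 1), (3, 2), (2, 4)}"
  "sfence_arcs 5 = {(2, 1), (3, 2), (2, 4), (5, 4)}"
  by (auto simp: sfence_arcs_le_5)

text \<open>The existentials range over \<open>sfence_arcs n\<close>, so an explicit arc set turns
  the condition into a finite Boolean combination of labels.\<close>

lemma labels_in_maximal_labelings_iff:
  assumes "length ls = n"
  shows "labels ls \<in> maximal_labelings n \<longleftrightarrow>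
     (\<forall>(a, b) \<in> sfence_arcs n. labels ls a \<noteq> Out \<longrightarrow> labels ls b = In) \<and>
     (\<forall>i \<in> {1..n}.
        (labels ls i = Out \<longrightarrow> (\<exists>(a, b) \<in> sfence_arcs n. a = i \<and> labels ls b \<noteq> In)) \<and>
        (labels ls i = In \<longrightarrow> (\<exists>(a, b) \<in> sfence_arcs n. b = i \<and> labels ls a \<noteq> Out)))"
proof -
  have "\<forall>i. i \<notin> {1..n} \<longrightarrow> labels ls i = Out"
    using assms by (simp add: labels_def)
  moreover have "(\<exists>(a, b) \<in> sfence_arcs n. a = i \<and> P b) \<longleftrightarrow> (\<exists>b. (i, b) \<in> sfence_arcs n \<and> P b)"
    "(\<exists>(a, b) \<in> sfence_arcs n. b = i \<and> P a) \<longleftrightarrow> (\<exists>a. (a, i) \<in> sfence_arcs n \<and> P a)" for i P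
    by auto
  ultimately show ?thesis
    unfolding maximal_labelings_def maximal_on_def mem_Collect_eq
    by (simp only: ball_conj_distrib) simp
qed

text \<open>A maximal labeling is \<open>Out\<close> outside \<open>{1..n}\<close>, so the list of
  its values on \<open>{1..n}\<close> loses nothing.\<close>

lemma maximal_labelings_eq_image:
  assumes "\<And>ls. length ls = n \<Longrightarrow> labels ls \<in> maximal_labelings n \<longleftrightarrow> ls \<in> S"
    and "\<And>ls. ls \<in> S \<Longrightarrow> length ls = n"
  shows "maximal_labelings n = labels ` S"
proof (intro equalityI subsetI)
  fix f assume f: "f \<in> maximal_labelings n"
  define ls where "ls = map (\<lambda>i. f (Suc i)) [0..<n]"
  have "f = labels ls"
  proof
    fix i show "f i = labels ls i"
      using f by (cases i) (auto simp: ls_def labels_def maximal_labelings_def)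
  qed
  moreover have "length ls = n" by (simp add: ls_def)
  ultimately show "f \<in> labels ` S" using f assms(1) by blast
qed (use assms in auto)

lemma length_eq_numeral_iff:
  "length xs = numeral k \<longleftrightarrow> (\<exists>y ys. xs = y # ys \<and> length ys = pred_numeral k)"
  by (simp add: numeral_eq_Suc length_Suc_conv)

lemma max_cube_poly_small:
  assumes "\<And>ls. length ls = n \<Longrightarrow> labels ls \<in> maximal_labelings n \<longleftrightarrow> ls \<in> set S"
    and "\<And>ls. ls \<in> set S \<Longrightarrow> length ls = n" and "distinct S"
  shows "max_cube_poly n = (\<Sum>ls\<leftarrow>S. monom 1 (length (filter (\<lambda>l. l = Free) ls)))"
proof -
  have "inj_on labels (set S)" using labels_inject assms(2) by (metis inj_onI)
  moreover have "maximal_labelings n = labels ` set S"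
    by (rule maximal_labelings_eq_image) (use assms in auto)
  ultimately have "max_cube_poly n = (\<Sum>ls \<in> set S. monom 1 (length (filter (\<lambda>l. l = Free) ls)))"
    by (simp add: max_cube_poly_eq sum.reindex free_count_labels)
  then show ?thesis using assms(3) by (simp add: sum_list_distinct_conv_sum_set)
qed

lemma atLeastAtMost_small:
  "{Suc 0..2} = {1, 2}" "{Suc 0..3} = {1, 2, 3}"
  "{Suc 0..4} = {1, 2, 3, 4}" "{Suc 0..5} = {1, 2, 3, 4, 5}"
  by auto

section \<open>The initial polynomials\<close>

lemma max_cube_poly_0: "max_cube_poly 0 = 1"
proof -
  let ?S = "[[]]"
  have "max_cube_poly 0 = (\<Sum>ls\<leftarrow>?S. monom 1 (length (filter (\<lambda>l. l = Free) ls)))"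
  proof (rule max_cube_poly_small)
    fix ls :: "label list" assume len: "length ls = 0"
    then have ls: "ls = []" by simp
    show "labels ls \<in> maximal_labelings 0 \<longleftrightarrow> ls \<in> set ?S"
      unfolding labels_in_maximal_labelings_iff[OF len] sfence_arcs_small
      by (simp add: ls labels_def atLeastAtMost_small)
  qed auto
  then show ?thesis by (simp add: monom_Suc monom_0)
qed

lemma max_cube_poly_1: "max_cube_poly 1 = [:0, 1:]"
proof -
  let ?S = "[[Free]]"
  have "max_cube_poly 1 = (\<Sum>ls\<leftarrow>?S. monom 1 (length (filter (\<lambda>l. l = Free) ls)))"
  proof (rule max_cube_poly_small)
    fix ls :: "label list" assume len: "length ls = 1"
    then obtain a where ls: "ls = [a]"
      by (auto simp: length_eq_numeral_iff length_Suc_conv)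
    show "labels ls \<in> maximal_labelings 1 \<longleftrightarrow> ls \<in> set ?S"
      unfolding labels_in_maximal_labelings_iff[OF len] sfence_arcs_small
      by (simp add: ls labels_def atLeastAtMost_small)
        (cases a; simp)
  qed auto
  then show ?thesis by (simp add: monom_Suc monom_0)
qed

lemma max_cube_poly_2: "max_cube_poly 2 = [:0, 2:]"
proof -
  let ?S = "[[Free, Out], [In, Free]]"
  have "max_cube_poly 2 = (\<Sum>ls\<leftarrow>?S. monom 1 (length (filter (\<lambda>l. l = Free) ls)))"
  proof (rule max_cube_poly_small)
    fix ls :: "label list" assume len: "length ls = 2"
    then obtain a b where ls: "ls = [a, b]"
      by (auto simp: length_eq_numeral_iff length_Suc_conv)
    show "labels ls \<in> maximal_labelings 2 \<longleftrightarrow> ls \<in> set ?S"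
      unfolding labels_in_maximal_labelings_iff[OF len] sfence_arcs_small
      by (simp add: ls labels_def atLeastAtMost_small)
        (cases a; cases b; simp)
  qed auto
  then show ?thesis by (simp add: monom_Suc monom_0)
qed

text \<open>The fence is a chain, so its filters form a path with three edges.\<close>

lemma max_cube_poly_3: "max_cube_poly 3 = [:0, 3:]"
proof -
  let ?S = "[[Free, Out, Out], [In, Free, Out], [In, In, Free]]"
  have "max_cube_poly 3 = (\<Sum>ls\<leftarrow>?S. monom 1 (length (filter (\<lambda>l. l = Free) ls)))"
  proof (rule max_cube_poly_small)
    fix ls :: "label list" assume len: "length ls = 3"
    then obtain a b c where ls: "ls = [a, b, c]"
      by (auto simp: length_eq_numeral_iff length_Suc_conv)
    show "labels ls \<in> maximal_labelings 3 \<longleftrightarrow> ls \<in> set ?S"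
      unfolding labels_in_maximal_labelings_iff[OF len] sfence_arcs_small
      by (simp add: ls labels_def atLeastAtMost_small)
        (cases a; cases b; cases c; simp)
  qed auto
  then show ?thesis by (simp add: monom_Suc monom_0)
qed

text \<open>The filters form a square with a path of two edges attached at the filter
  \<open>{1, 4}\<close>.\<close>

lemma max_cube_poly_4: "max_cube_poly 4 = [:0, 2, 1:]"
proof -
  let ?S = "[[Free, Out, Out, Free], [In, Free, Out, In], [In, In, Free, In]]"
  have "max_cube_poly 4 = (\<Sum>ls\<leftarrow>?S. monom 1 (length (filter (\<lambda>l. l = Free) ls)))"
  proof (rule max_cube_poly_small)
    fix ls :: "label list" assume len: "length ls = 4"
    then obtain a b c d where ls: "ls = [a, b, c, d]"
      by (auto simp: length_eq_numeral_iff length_Suc_conv)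
    show "labels ls \<in> maximal_labelings 4 \<longleftrightarrow> ls \<in> set ?S"
      unfolding labels_in_maximal_labelings_iff[OF len] sfence_arcs_small
      by (simp add: ls labels_def atLeastAtMost_small)
        (cases a; cases b; cases c; cases d; simp)
  qed auto
  then show ?thesis by (simp add: monom_Suc monom_0)
qed

text \<open>The recurrence would predict five squares here, so this value too is an initial
  one.\<close>

lemma max_cube_poly_5: "max_cube_poly 5 = [:0, 0, 4:]"
proof -
  let ?S = "[[Free, Out, Out, Free, Out], [Free, Out, Out, In, Free], [In, Free, Out, In, Free],
    [In, In, Free, In, Free]]"
  have "max_cube_poly 5 = (\<Sum>ls\<leftarrow>?S. monom 1 (length (filter (\<lambda>l. l = Free) ls)))"
  proof (rule max_cube_poly_small)
    fix ls :: "label list" assume len: "length ls = 5"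
    then obtain a b c d e where ls: "ls = [a, b, c, d, e]"
      by (auto simp: length_eq_numeral_iff length_Suc_conv)
    show "labels ls \<in> maximal_labelings 5 \<longleftrightarrow> ls \<in> set ?S"
      unfolding labels_in_maximal_labelings_iff[OF len] sfence_arcs_small
      by (simp add: ls labels_def atLeastAtMost_small)
        (cases a; cases b; cases c; cases d; cases e; simp)
  qed auto
  then show ?thesis by (simp add: monom_Suc monom_0)
qed

section \<open>The power series identity\<close>

lemma fps_nth_mult_X_power:
  fixes F :: "'a :: comm_ring_1 fps"
  shows "(fps_const c * fps_X ^ k * F) $ n = (if n < k then 0 else c * F $ (n - k))"
  by (simp add: mult.assoc fps_X_power_mult_nth)

text \<open>Coefficients from 6 on vanish by the recurrence; the numerator records how the initial
  polynomials deviate from it.\<close>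

lemma max_cube_series_mult_denominator:
  fixes x y :: "int poly fract fps"
  assumes "x = fps_const (to_fract [:0, 1:])" and "y = fps_X"
  shows "Abs_fps (\<lambda>n. to_fract (max_cube_poly n)) * (1 - x * y ^ 2 * (1 + y)) =
    1 + x * y * (1 + y) + 2 * x * y ^ 3 * (1 + y) - x ^ 2 * y ^ 3 * (1 + y) ^ 2" (is "?H * _ = ?N")
proof (rule fps_ext)
  fix n :: nat
  let ?t = "to_fract :: int poly \<Rightarrow> _"
  let ?x = "?t [:0, 1:]"
  have D: "?H * (1 - x * y ^ 2 * (1 + y)) =
      ?H - fps_const ?x * fps_X ^ 2 * ?H - fps_const ?x * fps_X ^ 3 * ?H"
    unfolding assms by (simp add: algebra_simps power2_eq_square power3_eq_cube)
  have two: "fps_const (2 * c) = 2 * fps_const c" and square: "fps_const (c ^ 2) = fps_const c ^ 2"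
    for c :: "int poly fract"
    by (simp_all add: numeral_fps_const)
  \<comment> \<open>The factors \<open>* 1\<close> give these terms the shape
    \<open>fps_const c * fps_X ^ k * F\<close> of \<open>fps_nth_mult_X_power\<close>.\<close>
  have N: "?N = 1 + fps_const ?x * fps_X ^ 1 * 1 + fps_const ?x * fps_X ^ 2 * 1
      + fps_const (2 * ?x) * fps_X ^ 3 * 1 - fps_const (?x ^ 2) * fps_X ^ 3 * 1
      + fps_const (2 * ?x) * fps_X ^ 4 * 1 - fps_const (2 * ?x ^ 2) * fps_X ^ 4 * 1
      - fps_const (?x ^ 2) * fps_X ^ 5 * 1"
    unfolding assms two square by algebra
  \<comment> \<open>Writing everything in \<open>[:0, 1:]\<close> lets \<open>to_fract\<close> be
    pushed through sums and products.\<close>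
  have "[:0, 2:] = [:0, 1:] + ([:0, 1:] :: int poly)"
    "[:0, 3:] = [:0, 1:] + [:0, 1:] + ([:0, 1:] :: int poly)"
    "[:0, 2, 1:] = [:0, 1:] + [:0, 1:] + [:0, 1:] * ([:0, 1:] :: int poly)"
    "[:0, 0, 4:] = ([:0, 1:] + [:0, 1:]) * ([:0, 1:] + [:0, 1:] :: int poly)"
    by simp_all
  then have to_fract_small: "?t [:0, 2:] = ?x + ?x" "?t [:0, 3:] = ?x + ?x + ?x"
    "?t [:0, 2, 1:] = ?x + ?x + ?x * ?x" "?t [:0, 0, 4:] = (?x + ?x) * (?x + ?x)"
    by (simp_all only: to_fract_add to_fract_mult)
  have "n = 0 \<or> n = 1 \<or> n = 2 \<or> n = 3 \<or> n = 4 \<or> n = 5 \<or> (\<exists>m. n = m + 6)"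
    by presburger
  then consider "n = 0" | "n = 1" | "n = 2" | "n = 3" | "n = 4" | "n = 5" | m where "n = m + 6"
    by blast
  then show "(?H * (1 - x * y ^ 2 * (1 + y))) $ n = ?N $ n"
  proof cases
    case 7
    have "?t (max_cube_poly (m + 3 + 3)) =
        ?x * ?t (max_cube_poly (m + 3 + 1)) + ?x * ?t (max_cube_poly (m + 3))"
      unfolding max_cube_poly_rec[of "m + 3", OF le_add2]
      by (simp only: to_fract_mult to_fract_add distrib_left)
    then show ?thesis
      unfolding D N fps_nth_mult_X_power fps_add_nth fps_sub_nth
      by (simp add: 7 fps_nth_mult_X_power add.commute[of _ m])
  qed (unfold D N fps_nth_mult_X_power fps_add_nth fps_sub_nth, simp_all add: max_cube_poly_0
    max_cube_poly_1[unfolded One_nat_def] max_cube_poly_2 max_cube_poly_3 max_cube_poly_4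
    max_cube_poly_5 to_fract_small algebra_simps power2_eq_square)
qed

theorem theorem5:
  fixes x y :: "int poly fract fps"
  assumes "x = fps_const (to_fract [:0, 1:])"
    and "y = fps_X"
  shows "Abs_fps (\<lambda>n. to_fract (max_cube_poly n)) =
           (1 + x * y * (1 + y) + 2 * x * y ^ 3 * (1 + y) - x ^ 2 * y ^ 3 * (1 + y) ^ 2) /
           (1 - x * y ^ 2 * (1 + y)) \<and>
         (1 + x * y * (1 + y) + 2 * x * y ^ 3 * (1 + y) - x ^ 2 * y ^ 3 * (1 + y) ^ 2) /
           (1 - x * y ^ 2 * (1 + y)) =
         - 2 * y + x * y + x * y ^ 2 + (1 + 2 * y) / (1 - x * y ^ 2 * (1 + y))"
proof -
  let ?H = "Abs_fps (\<lambda>n. to_fract (max_cube_poly n))"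
  let ?D = "1 - x * y ^ 2 * (1 + y)"
  let ?N = "1 + x * y * (1 + y) + 2 * x * y ^ 3 * (1 + y) - x ^ 2 * y ^ 3 * (1 + y) ^ 2"
  let ?p = "- 2 * y + x * y + x * y ^ 2"
  \<comment> \<open>The constant coefficient shows that the denominator is nonzero and can be
    cancelled.\<close>
  have "?D $ 0 = 1" by (simp add: assms(2) power2_eq_square)
  then have D: "?D \<noteq> 0" by (metis fps_zero_nth zero_neq_one)
  have "?H = ?N / ?D"
    unfolding max_cube_series_mult_denominator[OF assms, symmetric] using D by simp
  \<comment> \<open>Division with remainder in \<open>y\<close>: the quotient is \<open>?p\<close>
    and the remainder \<open>1 + 2 * y\<close>.\<close>
  moreover have "?N = ?p * ?D + (1 + 2 * y)"
    by (simp add: algebra_simps power2_eq_square power3_eq_cube)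
  then have "?N / ?D = (?p * ?D + (1 + 2 * y)) / ?D" by (rule arg_cong)
  then have "?N / ?D = ?p + (1 + 2 * y) / ?D"
    using D by simp
  ultimately show ?thesis by blast
qed

end
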